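(* Let $w$ be a word of length $N$ over an alphabet $\mathcal{A}_k$ with $k$ letters. Then for all integers $n$ with $1\le n<K_w$, \[p_w(n+1)-p_w(n)\le k\bigl(p_w(n)-p_w(n-1)\bigr).\]
   Context: A subword (factor) of $w=w_1\cdots w_N$ is a contiguous block $w_iw_{i+1}\cdots w_j$, and the empty word is the unique subword of length $0$. For $\ell\ge 0$, $p_w(\ell)$ is the number of distinct subwords of $w$ of length $\ell$ (so $p_w(0)=1$). $K_w$ denotes the minimal length of a suffix of $w$ that occurs exactly once in $w$ (as a subword). *)

theory Defs
  imports Complex_Main "HOL-Library.Sublist"
begin

definition subword_complexity :: "'a list \<Rightarrow> nat \<Rightarrow> nat" where
  "subword_complexity w l = card {u. sublist u w \<and> length u = l}"

text \<open>Occurrences are identified with their (0-based) starting positions, so the empty word occurs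
  \<open>length w + 1\<close> times in \<open>w\<close>.\<close>

definition occurrences :: "'a list \<Rightarrow> 'a list \<Rightarrow> nat set" where
  "occurrences u w = {i. i + length u \<le> length w \<and> take (length u) (drop i w) = u}"

text \<open>The minimum exists for every \<open>w\<close>, since \<open>w\<close> is a suffix of itself and occurs once in itself.\<close>

definition min_unique_suffix_length :: "'a list \<Rightarrow> nat" where
  "min_unique_suffix_length w =
     (LEAST m. \<exists>v. suffix v w \<and> length v = m \<and> card (occurrences v w) = 1)"

end

theory Submission imports Defs begin

text \<open>Writing \<open>d u\<close> for the number of letters that can follow a subword \<open>u\<close>, we have
  \<open>p (l + 1) - p l = (\<Sum>u. d u - 1)\<close>, summed over the subwords of length \<open>l\<close>. Below the minimal
  length of a unique suffix every subword reoccurs before the end of the word, so all terms are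
  nonnegative. Deleting the first letter of a subword of length \<open>n\<close> can only increase \<open>d\<close>, and at
  most \<open>k\<close> subwords become equal this way.\<close>

definition subwords :: "'a list \<Rightarrow> nat \<Rightarrow> 'a list set" where
  "subwords w l = {u. sublist u w \<and> length u = l}"

definition right_letters :: "'a list \<Rightarrow> 'a list \<Rightarrow> 'a set" where
  "right_letters w u = {x. sublist (u @ [x]) w}"

lemma sublist_Cons_leftD: "sublist (a # v) w \<Longrightarrow> sublist v w"
  by (meson sublist_Cons_right sublist_order.order.refl sublist_order.order.trans)

lemma finite_subwords: "finite (subwords w l)"
  by (rule finite_subset[of _ "set (sublists w)"]) (auto simp: subwords_def)

lemma finite_right_letters: "finite (right_letters w u)"
proof (rule finite_subset)
  show "right_letters w u \<subseteq> set w"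
    unfolding right_letters_def using set_mono_sublist by fastforce
qed simp

text \<open>Wherever \<open>x\<close> follows \<open>a # v\<close>, it also follows the copy of
  \<open>v\<close> inside.\<close>

lemma right_letters_Cons: "right_letters w (a # v) \<subseteq> right_letters w v"
  by (auto simp: right_letters_def dest: sublist_Cons_leftD)

text \<open>A subword of length \<open>Suc l\<close> splits uniquely into its prefix of length
  \<open>l\<close> and a last letter that can follow this prefix.\<close>

lemma subword_complexity_Suc:
  "subword_complexity w (Suc l) = (\<Sum>u\<in>subwords w l. card (right_letters w u))"
proof -
  have "subwords w (Suc l) = (\<lambda>(u, x). u @ [x]) ` Sigma (subwords w l) (right_letters w)"
  proof (intro equalityI subsetI)
    fix s assume s: "s \<in> subwords w (Suc l)"
    then obtain u x where sx: "s = u @ [x]"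
      by (metis (mono_tags, lifting) subwords_def length_Suc_conv_rev mem_Collect_eq)
    have "sublist u s" by (simp add: sx)
    with s sx have "u \<in> subwords w l" "x \<in> right_letters w u"
      by (auto simp: subwords_def right_letters_def intro: sublist_order.order.trans)
    with sx show "s \<in> (\<lambda>(u, x). u @ [x]) ` Sigma (subwords w l) (right_letters w)"
      by force
  qed (auto simp: subwords_def right_letters_def)
  moreover have "inj_on (\<lambda>(u, x). u @ [x]) (Sigma (subwords w l) (right_letters w))"
    by (auto simp: inj_on_def)
  ultimately have "card (subwords w (Suc l)) = card (Sigma (subwords w l) (right_letters w))"
    by (simp add: card_image)
  then show ?thesis
    by (simp add: subword_complexity_def flip: subwords_def)
      (simp add: finite_subwords finite_right_letters)
qed

text \<open>The difference is taken in \<open>int\<close>: a subword that occurs only at the end of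
  \<open>w\<close> has no right letter and contributes -1.\<close>

lemma subword_complexity_diff:
  "int (subword_complexity w (Suc l)) - int (subword_complexity w l) =
    (\<Sum>u\<in>subwords w l. int (card (right_letters w u)) - 1)"
  by (simp add: subword_complexity_Suc sum_subtractf)
    (simp add: subword_complexity_def subwords_def)

lemma sublist_occurrence:
  assumes "sublist u w"
  obtains i where "i \<in> occurrences u w"
proof -
  from assms obtain p s where "w = p @ u @ s" by (auto simp: sublist_def)
  then have "length p \<in> occurrences u w" by (simp add: occurrences_def)
  then show ?thesis by (rule that)
qed

lemma occurrence_right_letter:
  assumes "j \<in> occurrences u w" and "j + length u < length w"
  shows "w ! (j + length u) \<in> right_letters w u"
proof -
  have "u @ [w ! (j + length u)] = take (Suc (length u)) (drop j w)"
    using assms by (simp add: occurrences_def take_Suc_conv_app_nth)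
  moreover have "sublist (take (Suc (length u)) (drop j w)) w"
    by (meson sublist_drop sublist_order.order.trans sublist_take)
  ultimately show ?thesis by (simp add: right_letters_def)
qed

text \<open>A subword occurring only at the end of \<open>w\<close> would be a unique suffix, hence
  not shorter than the minimum.\<close>

lemma right_letters_nonempty:
  assumes "sublist u w" and "length u < min_unique_suffix_length w"
  shows "right_letters w u \<noteq> {}"
proof -
  obtain i where i: "i \<in> occurrences u w"
    using sublist_occurrence[OF assms(1)] .
  obtain j where "j \<in> occurrences u w" "j + length u < length w"
  proof (cases "i + length u < length w")
    case True
    with i that show ?thesis by blast
  next
    case False
    with i have len: "i + length u = length w" and "u = drop i w"
      by (auto simp: occurrences_def)
    then have "suffix u w" by (simp add: suffix_drop)
    \<comment> \<open>By minimality, no suffix as short as \<open>u\<close> occurs exactly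
      once.\<close>
    with assms(2) have "card (occurrences u w) \<noteq> 1"
      unfolding min_unique_suffix_length_def by (auto dest: not_less_Least)
    then have "occurrences u w \<noteq> {i}" by auto
    with i obtain j where j: "j \<in> occurrences u w" "j \<noteq> i" by blast
    then have "j + length u \<le> length w" by (simp add: occurrences_def)
    \<comment> \<open>No occurrence can start after \<open>i\<close>, so \<open>j < i\<close>, and a
      letter follows the occurrence at \<open>j\<close>.\<close>
    with len j that show ?thesis by simp
  qed
  then show ?thesis using occurrence_right_letter by blast
qed

theorem theorem3p6:
  fixes A :: "'a set" and w :: "'a list" and k N n :: nat
  assumes "finite A" and "card A = k"
    and "set w \<subseteq> A" and "length w = N"
    and "1 \<le> n" and "n < min_unique_suffix_length w"
  shows "int (subword_complexity w (n + 1)) - int (subword_complexity w n)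
    \<le> int k * (int (subword_complexity w n) - int (subword_complexity w (n - 1)))"
proof -
  obtain m where n: "n = Suc m" using \<open>1 \<le> n\<close> by (cases n) auto
  define e where "e u = int (card (right_letters w u)) - 1" for u
  \<comment> \<open>The bound on \<open>n\<close> enters here, through \<open>m < n\<close>.\<close>
  have e_nonneg: "e v \<ge> 0" if "v \<in> subwords w m" for v
  proof -
    have "right_letters w v \<noteq> {}"
      using that assms(6) n by (intro right_letters_nonempty) (auto simp: subwords_def)
    then show ?thesis
      using finite_right_letters[of w v] by (simp add: e_def Suc_le_eq card_gt_0_iff)
  qed
  have e_Cons: "e (a # v) \<le> e v" for a v
    unfolding e_def using card_mono[OF finite_right_letters right_letters_Cons, of w a v] by simp
  have sub: "subwords w n \<subseteq> (\<lambda>(a, v). a # v) ` (A \<times> subwords w m)"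
  proof
    fix u assume u: "u \<in> subwords w n"
    then obtain a v where av: "u = a # v" "length v = m"
      by (auto simp: subwords_def n length_Suc_conv)
    with u have "a \<in> A" "sublist v w"
      using set_mono_sublist[of u w] assms(3) by (auto simp: subwords_def dest: sublist_Cons_leftD)
    with av show "u \<in> (\<lambda>(a, v). a # v) ` (A \<times> subwords w m)"
      by (auto simp: subwords_def)
  qed
  have "(\<Sum>u\<in>subwords w n. e u) \<le> (\<Sum>u\<in>subwords w n. e (tl u))"
    using sub e_Cons by (intro sum_mono) auto
  \<comment> \<open>The larger index set may contain words that are not subwords of
    \<open>w\<close>; their tails still are, so the added terms are nonnegative.\<close>
  also have "\<dots> \<le> (\<Sum>u\<in>(\<lambda>(a, v). a # v) ` (A \<times> subwords w m). e (tl u))"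
    using sub e_nonneg by (intro sum_mono2) (auto simp: assms(1) finite_subwords)
  also have "\<dots> = (\<Sum>(a, v)\<in>A \<times> subwords w m. e v)"
    by (subst sum.reindex) (auto simp: inj_on_def case_prod_unfold)
  \<comment> \<open>Each \<open>v\<close> is counted once for every letter of \<open>A\<close>,
    which gives the factor \<open>k\<close>.\<close>
  also have "\<dots> = int k * (\<Sum>v\<in>subwords w m. e v)"
    by (simp add: assms(2) flip: sum.cartesian_product)
  finally show ?thesis
    using subword_complexity_diff[of w n] subword_complexity_diff[of w m] by (simp add: n e_def)
qed

end
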